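(* Let $X$ be a quandle and $R$ an associative ring (not necessarily with unity). Then the quandle $X$ is trivial (i.e. $x.y=x$ for all $x,y\in X$) if and only if $\Delta_R^2(X)=\{0\}$.
   Context: A quandle is a non-empty set $X$ with a binary operation $(x,y)\mapsto x.y$ such that: (R1) for all $x,y\in X$ there is a unique $z\in X$ with $x=z.y$; (R2) $(x.y).z=(x.z).(y.z)$ for all $x,y,z\in X$; (Q1) $x.x=x$ for all $x\in X$. The quandle ring $R[X]$ is the set of formal finite $R$-linear combinations $\sum_i\alpha_i x_i$ ($\alpha_i\in R$, $x_i\in X$) with the usual addition and the (generally non-associative) multiplication $(\sum_i\alpha_i x_i).(\sum_j\beta_j x_j)=\sum_{i,j}\alpha_i\beta_j(x_i.x_j)$. The augmentation map $\varepsilon:R[X]\to R$ is $\varepsilon(\sum_i\alpha_i x_i)=\sum_i\alpha_i$, and $\Delta_R(X)=\ker\varepsilon$ is the augmentation ideal. $\Delta_R^2(X)$ is the square of $\Delta_R(X)$, i.e. the additive subgroup generated by all products $u.v$ with $u,v\in\Delta_R(X)$.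
   Formalization: The ring R is additionally assumed to have some product ab ≠ 0; if all products in R vanish (e.g. R = 0), then Δ²_R(X) = {0} for every quandle, so the claim fails for instance for the dihedral quandle x.y = 2y − x on Z/3. *)

theory Defs
  imports "HOL-Library.Poly_Mapping" "HOL-Computational_Algebra.Group_Closure"
begin

locale quandle =
  fixes X :: "'q set" and qop :: "'q \<Rightarrow> 'q \<Rightarrow> 'q"
  assumes nonempty: "X \<noteq> {}"
    and closed: "\<And>x y. x \<in> X \<Longrightarrow> y \<in> X \<Longrightarrow> qop x y \<in> X"
    and R1: "\<And>x y. x \<in> X \<Longrightarrow> y \<in> X \<Longrightarrow> \<exists>!z. z \<in> X \<and> x = qop z y"
    and R2: "\<And>x y z. x \<in> X \<Longrightarrow> y \<in> X \<Longrightarrow> z \<in> X \<Longrightarrow>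
               qop (qop x y) z = qop (qop x z) (qop y z)"
    and Q1: "\<And>x. x \<in> X \<Longrightarrow> qop x x = x"

definition trivial_quandle :: "'q set \<Rightarrow> ('q \<Rightarrow> 'q \<Rightarrow> 'q) \<Rightarrow> bool" where
  "trivial_quandle X qop \<longleftrightarrow> (\<forall>x\<in>X. \<forall>y\<in>X. qop x y = x)"

text \<open>
  A formal finite linear combination of elements of \<open>X\<close> is a finitely supported
  coefficient function whose support lies in \<open>X\<close>; addition is that of
  \<open>poly_mapping\<close>.  The multiplication of \<open>poly_mapping\<close> needs a monoid on
  the index type, so the product of the quandle ring is a separate operation.
  The type class \<open>ring\<close> of the coefficients does not require a unit element.
\<close>

definition quandle_ring :: "'q set \<Rightarrow> ('q \<Rightarrow>\<^sub>0 'r::ring) set" where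
  "quandle_ring X = {u. Poly_Mapping.keys u \<subseteq> X}"

definition quandle_ring_mult ::
    "('q \<Rightarrow> 'q \<Rightarrow> 'q) \<Rightarrow> ('q \<Rightarrow>\<^sub>0 'r::ring) \<Rightarrow> ('q \<Rightarrow>\<^sub>0 'r) \<Rightarrow> ('q \<Rightarrow>\<^sub>0 'r)" where
  "quandle_ring_mult qop u v =
     (\<Sum>x\<in>Poly_Mapping.keys u. \<Sum>y\<in>Poly_Mapping.keys v.
        Poly_Mapping.single (qop x y) (Poly_Mapping.lookup u x * Poly_Mapping.lookup v y))"

definition augmentation :: "('q \<Rightarrow>\<^sub>0 'r::ring) \<Rightarrow> 'r" where
  "augmentation u = (\<Sum>x\<in>Poly_Mapping.keys u. Poly_Mapping.lookup u x)"

definition augmentation_ideal :: "'q set \<Rightarrow> ('q \<Rightarrow>\<^sub>0 'r::ring) set" where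
  "augmentation_ideal X = {u \<in> quandle_ring X. augmentation u = 0}"

definition augmentation_ideal_square ::
    "'q set \<Rightarrow> ('q \<Rightarrow> 'q \<Rightarrow> 'q) \<Rightarrow> ('q \<Rightarrow>\<^sub>0 'r::ring) set" where
  "augmentation_ideal_square X qop =
     group_closure {quandle_ring_mult qop u v | u v.
       u \<in> augmentation_ideal X \<and> v \<in> augmentation_ideal X}"

end

theory Submission
  imports Defs
begin

text \<open>
  If \<open>X\<close> is trivial then \<open>u.v = \<epsilon>(v) u\<close> (coefficients on the right), which vanishes on
  \<open>\<Delta>\<close>.  Conversely, for distinct \<open>x, y\<close> and \<open>a b \<noteq> 0\<close> the product of \<open>a x - a y\<close> and
  \<open>b x - b y\<close> is \<open>ab (x + y - x.y - y.x)\<close>.  Since right translation by \<open>y\<close> is injective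
  and fixes \<open>y\<close>, \<open>x.y \<noteq> y\<close>; so the coefficient of this product at \<open>y\<close> is \<open>ab\<close>
  unless \<open>y.x = y\<close>.
\<close>

text \<open>Coefficients vanish off the keys, so extra indices add only zero terms. Summing over a
  fixed finite set avoids determining the exact keys of a difference, which may cancel.\<close>

lemma quandle_ring_mult_superset:
  assumes "finite A" "finite B" "Poly_Mapping.keys u \<subseteq> A" "Poly_Mapping.keys v \<subseteq> B"
  shows "quandle_ring_mult qop u v =
    (\<Sum>x\<in>A. \<Sum>y\<in>B. Poly_Mapping.single (qop x y)
       (Poly_Mapping.lookup u x * Poly_Mapping.lookup v y))"
proof -
  have "quandle_ring_mult qop u v =
    (\<Sum>x\<in>Poly_Mapping.keys u. \<Sum>y\<in>B. Poly_Mapping.single (qop x y)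
       (Poly_Mapping.lookup u x * Poly_Mapping.lookup v y))"
    unfolding quandle_ring_mult_def using assms
    by (intro sum.cong sum.mono_neutral_left) (auto simp: in_keys_iff)
  also have "\<dots> = (\<Sum>x\<in>A. \<Sum>y\<in>B. Poly_Mapping.single (qop x y)
       (Poly_Mapping.lookup u x * Poly_Mapping.lookup v y))"
    using assms by (intro sum.mono_neutral_left) (auto simp: in_keys_iff)
  finally show ?thesis .
qed

lemma augmentation_superset:
  assumes "finite A" "Poly_Mapping.keys u \<subseteq> A"
  shows "augmentation u = (\<Sum>x\<in>A. Poly_Mapping.lookup u x)"
  unfolding augmentation_def using assms
  by (intro sum.mono_neutral_left) (auto simp: in_keys_iff)

lemma keys_single_diff_subset:
  "Poly_Mapping.keys (Poly_Mapping.single x a - Poly_Mapping.single y b) \<subseteq> {x, y}"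
  by (auto simp: in_keys_iff lookup_minus lookup_single when_def split: if_splits)

lemma single_diff_in_augmentation_ideal:
  fixes a :: "'r::ring"
  assumes "x \<in> X" "y \<in> X"
  shows "Poly_Mapping.single x a - Poly_Mapping.single y a \<in> augmentation_ideal X"
proof -
  have "augmentation (Poly_Mapping.single x a - Poly_Mapping.single y a) = 0"
    \<comment> \<open>If \<open>x = y\<close> the difference is 0 and \<open>{x, y}\<close> has one
      element; otherwise the sum over \<open>{x, y}\<close> is \<open>a + (- a)\<close>.\<close>
    by (cases "x = y")
      (auto simp: augmentation_def[of 0] augmentation_superset[OF _ keys_single_diff_subset] lookup_minus lookup_single)
  then show ?thesis
    using assms keys_single_diff_subset[of x a y a]
    by (auto simp: augmentation_ideal_def quandle_ring_def)
qed

text \<open>This is the uniqueness half of \<open>R1\<close>, applied to the element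
  \<open>qop x z\<close>.\<close>

lemma (in quandle) qop_right_cancel:
  assumes "x \<in> X" "y \<in> X" "z \<in> X" "qop x z = qop y z"
  shows "x = y"
  using R1[OF closed[OF assms(1,3)] assms(3)] assms by metis

lemma single_sum:
  "Poly_Mapping.single k (sum f A) = (\<Sum>x\<in>A. Poly_Mapping.single k (f x))"
  by (induction A rule: infinite_finite_induct) (simp_all add: single_add)

lemma quandle_ring_mult_trivial:
  assumes "trivial_quandle X qop" "u \<in> quandle_ring X" "v \<in> augmentation_ideal X"
  shows "quandle_ring_mult qop u v = 0"
proof -
  have "quandle_ring_mult qop u v = (\<Sum>x\<in>Poly_Mapping.keys u. \<Sum>y\<in>Poly_Mapping.keys v.
      Poly_Mapping.single x (Poly_Mapping.lookup u x * Poly_Mapping.lookup v y))"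
    unfolding quandle_ring_mult_def using assms
    by (intro sum.cong refl)
      (auto simp: trivial_quandle_def quandle_ring_def augmentation_ideal_def subset_iff)
  also have "\<dots> = (\<Sum>x\<in>Poly_Mapping.keys u.
      Poly_Mapping.single x (Poly_Mapping.lookup u x * augmentation v))"
    by (simp add: single_sum sum_distrib_left augmentation_def)
  also have "\<dots> = 0"
    using assms(3) by (simp add: augmentation_ideal_def)
  finally show ?thesis .
qed

lemma (in quandle) lookup_quandle_ring_mult_single_diff:
  fixes a b :: "'r::ring"
  assumes "x \<in> X" "y \<in> X" "x \<noteq> y"
  shows "Poly_Mapping.lookup (quandle_ring_mult qop
      (Poly_Mapping.single x a - Poly_Mapping.single y a)
      (Poly_Mapping.single x b - Poly_Mapping.single y b)) y =
    (if qop y x = y then 0 else a * b)"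
proof -
  have "qop x y \<noteq> y"
    using qop_right_cancel[of x y y] Q1 assms by auto
  \<comment> \<open>Of the four terms, those at \<open>qop x x = x\<close> and
    \<open>qop x y\<close> miss \<open>y\<close>. The one at \<open>qop y y = y\<close> gives
    \<open>(- a) * (- b) = a * b\<close>; the one at \<open>qop y x\<close> gives
    \<open>- (a * b)\<close>, cancelling it exactly when \<open>qop y x = y\<close>.\<close>
  then show ?thesis
    using assms Q1
    by (simp add: quandle_ring_mult_superset[OF _ _ keys_single_diff_subset keys_single_diff_subset]
        lookup_minus lookup_add lookup_single when_def)
qed

text \<open>The second assumption excludes rings with zero multiplication, over which the square is
  zero for every quandle.\<close>

theorem theorem3p5:
  fixes X :: "'q set" and qop :: "'q \<Rightarrow> 'q \<Rightarrow> 'q"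
  assumes "quandle X qop"
    and "\<exists>a b :: 'r::ring. a * b \<noteq> 0"
  shows "trivial_quandle X qop \<longleftrightarrow>
         augmentation_ideal_square X qop = {0 :: 'q \<Rightarrow>\<^sub>0 'r}"
proof
  assume "trivial_quandle X qop"
  then have "{quandle_ring_mult qop u v | u v. u \<in> augmentation_ideal X
      \<and> v \<in> augmentation_ideal X} \<subseteq> {0 :: 'q \<Rightarrow>\<^sub>0 'r}"
    by (auto simp: quandle_ring_mult_trivial augmentation_ideal_def)
  moreover have "w = 0" if "S \<subseteq> {0}" "w \<in> group_closure S" for S and w :: "'q \<Rightarrow>\<^sub>0 'r"
    using that(2) by (induction rule: group_closure.induct) (use that(1) in auto)
  ultimately show "augmentation_ideal_square X qop = {0 :: 'q \<Rightarrow>\<^sub>0 'r}"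
    unfolding augmentation_ideal_square_def by (auto intro: group_closure.intros)
next
  assume square: "augmentation_ideal_square X qop = {0 :: 'q \<Rightarrow>\<^sub>0 'r}"
  interpret quandle X qop by fact
  obtain a b :: 'r where ab: "a * b \<noteq> 0" using assms(2) by blast
  have "qop y x = y" if "x \<in> X" "y \<in> X" for x y
  proof (cases "x = y")
    case True
    then show ?thesis using Q1 that by simp
  next
    case False
    have "quandle_ring_mult qop (Poly_Mapping.single x a - Poly_Mapping.single y a)
        (Poly_Mapping.single x b - Poly_Mapping.single y b) \<in> augmentation_ideal_square X qop"
      unfolding augmentation_ideal_square_def
      using single_diff_in_augmentation_ideal[OF that]
      by (intro group_closure.base) blast
    \<comment> \<open>The product lies in \<open>{0}\<close>, so its coefficient at \<open>y\<close>
      vanishes.\<close>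
    then have "(if qop y x = y then 0 else a * b) = 0"
      using lookup_quandle_ring_mult_single_diff[OF that False, of a b] square by simp
    then show ?thesis using ab by (simp split: if_splits)
  qed
  then show "trivial_quandle X qop"
    by (simp add: trivial_quandle_def)
qed

end
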